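(* Let $T=(a_{ij})$ be a positive finite or infinite matrix which is embeddable into a positive semigroup $T(\cdot)=(a_{ij}(\cdot))$, i.e., $(T(t))_{t\ge0}$ is a positive $C_0$-semigroup with $T(1)=T$ and $T(t)=(a_{ij}(t))$ for $t\geq 0$. Then the following holds. (a) $a_{jj}(t)>0$ for every $t\ge0$ and every $j$. (b) If $a_{ij}=0$ for some $i\neq j$, then $a_{ij}(t)=0$ for every $t\in[0,1]$. Moreover, if $T(\cdot)$ is analytic, then $a_{ij}(t)=0$ for every $t\in[0,\infty)$.
   Context: An infinite matrix is a bounded linear operator on one of the complex sequence spaces $c_0$ or $\ell^p$, $1\le p<\infty$, identified with its matrix representation with respect to the canonical unit vectors $e_j$; a finite matrix is a $d\times d$ matrix acting on $\mathbb{C}^d$. A (finite or infinite) matrix is positive if all its entries are $\ge0$. A $C_0$-semigroup (strongly continuous semigroup) $(T(t))_{t\ge0}$ on the respective space is positive if each $T(t)$ is positive. *)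

theory Defs
  imports "HOL-Analysis.Analysis" "HOL-Library.Complex_Order"
begin

text \<open>
  Vectors of every underlying space are functions of type \<^typ>\<open>nat \<Rightarrow> complex\<close>; elements of
  the \<open>d\<close>-dimensional space are the sequences vanishing outside \<open>{..<d}\<close>.
  Indices start at 0.
\<close>

datatype seq_space = Fin_Dim nat | C_Zero | Ell real

fun valid_space :: "seq_space \<Rightarrow> bool" where
  "valid_space (Fin_Dim d) \<longleftrightarrow> 0 < d"
| "valid_space C_Zero \<longleftrightarrow> True"
| "valid_space (Ell p) \<longleftrightarrow> 1 \<le> p"

fun indices :: "seq_space \<Rightarrow> nat set" where
  "indices (Fin_Dim d) = {..<d}"
| "indices C_Zero = UNIV"
| "indices (Ell p) = UNIV"

fun vectors :: "seq_space \<Rightarrow> (nat \<Rightarrow> complex) set" where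
  "vectors (Fin_Dim d) = {x. \<forall>j\<ge>d. x j = 0}"
| "vectors C_Zero = {x. x \<longlonglongrightarrow> 0}"
| "vectors (Ell p) = {x. summable (\<lambda>j. norm (x j) powr p)}"

fun seq_norm :: "seq_space \<Rightarrow> (nat \<Rightarrow> complex) \<Rightarrow> real" where
  "seq_norm (Fin_Dim d) x = L2_set (\<lambda>j. norm (x j)) {..<d}"
| "seq_norm C_Zero x = (SUP j. norm (x j))"
| "seq_norm (Ell p) x = (\<Sum>j. norm (x j) powr p) powr (1 / p)"

type_synonym seq_op = "(nat \<Rightarrow> complex) \<Rightarrow> (nat \<Rightarrow> complex)"

text \<open>Only the values of an operator on \<^term>\<open>vectors S\<close> are meaningful.\<close>

definition bounded_op :: "seq_space \<Rightarrow> seq_op \<Rightarrow> bool" where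
  "bounded_op S A \<longleftrightarrow>
     (\<forall>x\<in>vectors S. A x \<in> vectors S) \<and>
     (\<forall>x\<in>vectors S. \<forall>y\<in>vectors S. A (\<lambda>k. x k + y k) = (\<lambda>k. A x k + A y k)) \<and>
     (\<forall>c. \<forall>x\<in>vectors S. A (\<lambda>k. c * x k) = (\<lambda>k. c * A x k)) \<and>
     (\<exists>M. \<forall>x\<in>vectors S. seq_norm S (A x) \<le> M * seq_norm S x)"

definition op_norm :: "seq_space \<Rightarrow> seq_op \<Rightarrow> real" where
  "op_norm S A = (SUP x\<in>{x \<in> vectors S. seq_norm S x \<le> 1}. seq_norm S (A x))"

definition unit_vec :: "nat \<Rightarrow> nat \<Rightarrow> complex" where
  "unit_vec j = (\<lambda>k. if k = j then 1 else 0)"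

definition entry :: "seq_op \<Rightarrow> nat \<Rightarrow> nat \<Rightarrow> complex" where
  "entry A i j = A (unit_vec j) i"

text \<open>
  The order on \<^typ>\<open>complex\<close> is that of \<^theory>\<open>HOL-Library.Complex_Order\<close>:
  \<open>0 \<le> z\<close> (\<open>0 < z\<close>) means that \<open>z\<close> is a nonnegative (positive) real number.
\<close>

definition positive_matrix :: "seq_space \<Rightarrow> seq_op \<Rightarrow> bool" where
  "positive_matrix S A \<longleftrightarrow> (\<forall>i\<in>indices S. \<forall>j\<in>indices S. 0 \<le> entry A i j)"

definition C0_semigroup :: "seq_space \<Rightarrow> (real \<Rightarrow> seq_op) \<Rightarrow> bool" where
  "C0_semigroup S T \<longleftrightarrow>
     (\<forall>t\<ge>0. bounded_op S (T t)) \<and>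
     (\<forall>x\<in>vectors S. T 0 x = x) \<and>
     (\<forall>s\<ge>0. \<forall>t\<ge>0. \<forall>x\<in>vectors S. T (s + t) x = T s (T t x)) \<and>
     (\<forall>x\<in>vectors S. \<forall>t\<ge>0.
        ((\<lambda>s. seq_norm S (\<lambda>k. T s x k - T t x k)) \<longlongrightarrow> 0) (at t within {0..}))"

definition positive_C0_semigroup :: "seq_space \<Rightarrow> (real \<Rightarrow> seq_op) \<Rightarrow> bool" where
  "positive_C0_semigroup S T \<longleftrightarrow> C0_semigroup S T \<and> (\<forall>t\<ge>0. positive_matrix S (T t))"

definition embeds_into :: "seq_space \<Rightarrow> seq_op \<Rightarrow> (real \<Rightarrow> seq_op) \<Rightarrow> bool" where
  "embeds_into S A T \<longleftrightarrow> (\<forall>x\<in>vectors S. T 1 x = A x)"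

definition sector :: "real \<Rightarrow> complex set" where
  "sector \<delta> = {z. z \<noteq> 0 \<and> \<bar>Arg z\<bar> < \<delta>}"

text \<open>Complex differentiability at \<open>z\<close> with respect to the operator norm.\<close>

definition op_differentiable :: "seq_space \<Rightarrow> (complex \<Rightarrow> seq_op) \<Rightarrow> complex \<Rightarrow> bool" where
  "op_differentiable S U z \<longleftrightarrow>
     (\<exists>D. bounded_op S D \<and>
        ((\<lambda>h. op_norm S (\<lambda>x k. (U (z + h) x k - U z x k) / h - D x k)) \<longlongrightarrow> 0) (at 0))"

text \<open>
  The semigroup is not required to be bounded on smaller sectors, and continuity at 0 is strong
  continuity along each strictly smaller sector.
\<close>

definition analytic_semigroup_of_angle ::
    "seq_space \<Rightarrow> real \<Rightarrow> (complex \<Rightarrow> seq_op) \<Rightarrow> bool" where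
  "analytic_semigroup_of_angle S \<delta> U \<longleftrightarrow>
     (\<forall>z\<in>insert 0 (sector \<delta>). bounded_op S (U z)) \<and>
     (\<forall>x\<in>vectors S. U 0 x = x) \<and>
     (\<forall>z\<in>sector \<delta>. \<forall>w\<in>sector \<delta>. \<forall>x\<in>vectors S. U (z + w) x = U z (U w x)) \<and>
     (\<forall>z\<in>sector \<delta>. op_differentiable S U z) \<and>
     (\<forall>\<delta>'. 0 < \<delta>' \<and> \<delta>' < \<delta> \<longrightarrow> (\<forall>x\<in>vectors S.
        ((\<lambda>z. seq_norm S (\<lambda>k. U z x k - x k)) \<longlongrightarrow> 0) (at 0 within sector \<delta>')))"

definition analytic_semigroup :: "seq_space \<Rightarrow> (real \<Rightarrow> seq_op) \<Rightarrow> bool" where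
  "analytic_semigroup S T \<longleftrightarrow>
     (\<exists>\<delta> U. 0 < \<delta> \<and> \<delta> \<le> pi / 2 \<and> analytic_semigroup_of_angle S \<delta> U \<and>
        (\<forall>t\<ge>0. \<forall>x\<in>vectors S. U (of_real t) x = T t x))"

end

theory Submission
  imports Defs "HOL-Complex_Analysis.Conformal_Mappings"
begin

text \<open>
  The engine is the inequality \<open>a\<^sub>i\<^sub>j(s + t) \<ge> a\<^sub>i\<^sub>k(s) a\<^sub>k\<^sub>j(t)\<close> (\<open>entry_semigroup_ge\<close>): an entry of the product
  \<open>T(s) T(t)\<close> is a sum of nonnegative terms and so dominates each single term. In infinite dimensions
  this rests on the fact that an operator with nonnegative entries maps nonnegative vectors to
  nonnegative vectors (\<open>positive_matrix_preserves_nonneg\<close>), which follows from density of the finitely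
  supported vectors.

  Taking \<open>i = k = j\<close>, the diagonal entries are supermultiplicative in time. By strong
  continuity they are near \<open>1\<close> for small times, hence positive, and supermultiplicativity spreads
  positivity to all times (\<open>diagonal_entry_pos\<close>).

  Taking \<open>k = i\<close> and total time \<open>1\<close> gives \<open>a\<^sub>i\<^sub>j(1) \<ge> a\<^sub>i\<^sub>i(1 - t) a\<^sub>i\<^sub>j(t)\<close>. As the diagonal factor is positive,
  a zero of \<open>a\<^sub>i\<^sub>j\<close> at time \<open>1\<close> forces zeros at all earlier times.

  If the semigroup is analytic, \<open>a\<^sub>i\<^sub>j\<close> extends to a holomorphic function on a sector around the
  positive half-line (\<open>entry_holomorphic_on_sector\<close>). It vanishes on \<open>(0, 1]\<close>, so by the identity
  theorem it vanishes on the whole sector (\<open>analytic_semigroup_entry_zero\<close>).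
\<close>

section \<open>Sequence spaces and their norms\<close>

lemma seq_norm_Ell_powr:
  assumes "1 \<le> p" "x \<in> vectors (Ell p)"
  shows "seq_norm (Ell p) x powr p = (\<Sum>j. norm (x j) powr p)"
  using assms by (simp add: powr_powr suminf_nonneg)

lemma seq_norm_Ell_leI:
  assumes "1 \<le> p" "x \<in> vectors (Ell p)" "0 \<le> r" "(\<Sum>j. norm (x j) powr p) \<le> r powr p"
  shows "seq_norm (Ell p) x \<le> r"
proof -
  have "0 \<le> (\<Sum>j. norm (x j) powr p)"
    using assms(2) by (intro suminf_nonneg) auto
  then have "seq_norm (Ell p) x \<le> (r powr p) powr (1 / p)"
    using assms by (auto intro!: powr_mono2)
  also have "\<dots> = r" using assms by (simp add: powr_powr)
  finally show ?thesis .
qed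

lemma bdd_above_norm_c0:
  assumes "x \<in> vectors C_Zero"
  shows "bdd_above (range (\<lambda>j. norm (x j)))"
proof -
  have "convergent x" using assms by (auto simp: convergent_def)
  then have "Bseq x" by (rule convergent_imp_Bseq)
  then show ?thesis by (auto simp: Bseq_def bdd_above_def)
qed

text \<open>
  Coordinate functionals are contractions. This is what turns every norm convergence or norm
  bound below into one for matrix entries.
\<close>

lemma coord_le_seq_norm:
  assumes "valid_space S" "x \<in> vectors S"
  shows "norm (x i) \<le> seq_norm S x"
proof (cases S)
  case (Fin_Dim d)
  show ?thesis
  proof (cases "i < d")
    case True
    then show ?thesis
      using Fin_Dim member_le_L2_set[of "{..<d}" i "\<lambda>j. norm (x j)"] by simp
  next
    case False
    then show ?thesis using Fin_Dim assms by simp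
  qed
next
  case C_Zero
  then show ?thesis
    using assms bdd_above_norm_c0[of x] by (auto intro: cSUP_upper)
next
  case (Ell p)
  have p: "1 \<le> p" "summable (\<lambda>j. norm (x j) powr p)" using assms Ell by auto
  have "norm (x i) powr p \<le> (\<Sum>j. norm (x j) powr p)"
    using sum_le_suminf[OF p(2), of "{i}"] by simp
  then have "(norm (x i) powr p) powr (1 / p) \<le> seq_norm S x"
    using p Ell by (auto intro!: powr_mono2)
  then show ?thesis using p by (simp add: powr_powr)
qed

lemma seq_norm_nonneg:
  assumes "valid_space S" "x \<in> vectors S"
  shows "0 \<le> seq_norm S x"
  using coord_le_seq_norm[OF assms, of 0] norm_ge_zero order_trans by blast

text \<open>
  The spaces are solid: membership depends only on the moduli of the coordinates. This yields at
  once that truncations, tails, single-coordinate modifications and scalar multiples stay in the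
  space.
\<close>

lemma vectors_dominated:
  assumes "valid_space S" "x \<in> vectors S" "\<And>k. norm (y k) \<le> c * norm (x k)"
  shows "y \<in> vectors S"
proof (cases S)
  case (Fin_Dim d)
  then show ?thesis
  proof -
    have "y j = 0" if "j \<ge> d" for j
      using assms(2) assms(3)[of j] Fin_Dim that by simp
    then show ?thesis using Fin_Dim by simp
  qed
next
  case C_Zero
  then have "(\<lambda>k. norm (x k)) \<longlonglongrightarrow> 0" using assms by (simp add: tendsto_norm_zero)
  then have "(\<lambda>k. c * norm (x k)) \<longlonglongrightarrow> 0" by (rule tendsto_mult_right_zero)
  then have "y \<longlonglongrightarrow> 0"
    by (rule Lim_null_comparison[rotated]) (simp add: assms(3))
  then show ?thesis using C_Zero by simp
next
  case (Ell p)
  have p: "1 \<le> p" "summable (\<lambda>j. norm (x j) powr p)" using assms Ell by auto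
  have le: "norm (y k) \<le> \<bar>c\<bar> * norm (x k)" for k
    by (rule order_trans[OF assms(3)]) (simp add: mult_right_mono)
  have "norm (y k) powr p \<le> \<bar>c\<bar> powr p * norm (x k) powr p" for k
    using powr_mono2[OF _ _ le, of p k] p by (simp add: powr_mult)
  then have "summable (\<lambda>k. norm (y k) powr p)"
    by (intro summable_comparison_test'[OF summable_mult[OF p(2), of "\<bar>c\<bar> powr p"]]) simp
  then show ?thesis using Ell by simp
qed

lemma seq_norm_dominated:
  assumes "valid_space S" "x \<in> vectors S" "0 \<le> c" "\<And>k. norm (y k) \<le> c * norm (x k)"
  shows "seq_norm S y \<le> c * seq_norm S x"
proof (cases S)
  case (Fin_Dim d)
  have "L2_set (\<lambda>j. norm (y j)) {..<d} \<le> L2_set (\<lambda>j. c * norm (x j)) {..<d}"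
    by (rule L2_set_mono) (use assms in auto)
  then show ?thesis using Fin_Dim assms by (simp add: L2_set_right_distrib)
next
  case C_Zero
  have "norm (y k) \<le> c * seq_norm S x" for k
    using assms(4)[of k] mult_left_mono[OF coord_le_seq_norm[OF assms(1,2), of k] assms(3)]
    by linarith
  then show ?thesis using C_Zero by (auto intro: cSUP_least)
next
  case (Ell p)
  have p: "1 \<le> p" "summable (\<lambda>j. norm (x j) powr p)" "x \<in> vectors (Ell p)" using assms Ell by auto
  have y: "y \<in> vectors (Ell p)" using vectors_dominated[OF assms(1,2,4)] Ell by simp
  have le: "norm (y k) powr p \<le> c powr p * norm (x k) powr p" for k
    using powr_mono2[OF _ _ assms(4), of p k] p assms(3) by (simp add: powr_mult)
  have "(\<Sum>k. norm (y k) powr p) \<le> (\<Sum>k. c powr p * norm (x k) powr p)"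
    using y p by (intro suminf_le le summable_mult) auto
  also have "\<dots> = (c * seq_norm (Ell p) x) powr p"
    using seq_norm_Ell_powr[OF p(1,3)] seq_norm_nonneg[OF assms(1,2)] assms(3) p Ell
    by (simp add: suminf_mult powr_mult del: seq_norm.simps)
  finally show ?thesis
    unfolding Ell using p y assms(3) seq_norm_nonneg[OF assms(1,2)] Ell
    by (intro seq_norm_Ell_leI) (auto simp del: seq_norm.simps)
qed

text \<open>
  Only closure under addition and boundedness of sums of bounded operators are at stake, so the
  constant is immaterial and Minkowski's inequality can be avoided: for \<open>\<ell>\<^sup>p\<close> the pointwise bound
  \<open>\<bar>x + y\<bar>\<^sup>p \<le> 2\<^sup>p (\<bar>x\<bar>\<^sup>p + \<bar>y\<bar>\<^sup>p)\<close> is summed, and \<open>2 \<le> 2\<^sup>p\<close> absorbs the remaining factor.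
\<close>

lemma
  assumes "valid_space S" "x \<in> vectors S" "y \<in> vectors S"
  shows vectors_add: "(\<lambda>k. x k + y k) \<in> vectors S"
    and seq_norm_quasi_triangle:
      "seq_norm S (\<lambda>k. x k + y k) \<le> 4 * (seq_norm S x + seq_norm S y)"
proof -
  note nn = seq_norm_nonneg[OF assms(1,2)] seq_norm_nonneg[OF assms(1,3)]
  have "(\<lambda>k. x k + y k) \<in> vectors S \<and>
    seq_norm S (\<lambda>k. x k + y k) \<le> 4 * (seq_norm S x + seq_norm S y)"
  proof (cases S)
    case (Fin_Dim d)
    have "L2_set (\<lambda>j. norm (x j + y j)) {..<d} \<le> L2_set (\<lambda>j. norm (x j) + norm (y j)) {..<d}"
      by (rule L2_set_mono) (auto intro: norm_triangle_ineq)
    also have "\<dots> \<le> L2_set (\<lambda>j. norm (x j)) {..<d} + L2_set (\<lambda>j. norm (y j)) {..<d}"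
      by (rule L2_set_triangle_ineq)
    finally show ?thesis using Fin_Dim assms nn by (auto simp del: L2_set_nonneg)
  next
    case C_Zero
    have "norm (x k + y k) \<le> 4 * (seq_norm S x + seq_norm S y)" for k
      using norm_triangle_ineq[of "x k" "y k"] nn
        coord_le_seq_norm[OF assms(1,2), of k] coord_le_seq_norm[OF assms(1,3), of k]
      by argo
    then show ?thesis
      using C_Zero assms tendsto_add_zero[of x sequentially y] by (auto intro: cSUP_least)
  next
    case (Ell p)
    let ?a = "seq_norm (Ell p) x" and ?b = "seq_norm (Ell p) y"
    have p: "1 \<le> p" "summable (\<lambda>j. norm (x j) powr p)" "summable (\<lambda>j. norm (y j) powr p)"
      "x \<in> vectors (Ell p)" "y \<in> vectors (Ell p)"
      using assms Ell by auto
    have nn: "0 \<le> ?a" "0 \<le> ?b" using nn Ell by auto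
    let ?g = "\<lambda>k. 2 powr p * (norm (x k) powr p + norm (y k) powr p)"
    have le: "norm (x k + y k) powr p \<le> ?g k" for k
    proof -
      let ?m = "max (norm (x k)) (norm (y k))"
      have "norm (x k + y k) \<le> 2 * ?m"
        using norm_triangle_ineq[of "x k" "y k"] by linarith
      then have "norm (x k + y k) powr p \<le> (2 * ?m) powr p"
        using p by (intro powr_mono2) auto
      also have "\<dots> = 2 powr p * ?m powr p" by (simp add: powr_mult)
      also have "?m powr p \<le> norm (x k) powr p + norm (y k) powr p"
        by (auto simp: max_def)
      finally show ?thesis by simp
    qed
    have sg: "summable ?g" using p by (intro summable_mult summable_add)
    then have v: "(\<lambda>k. x k + y k) \<in> vectors (Ell p)"
      by (auto intro!: summable_comparison_test'[OF sg] le)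
    have "(\<Sum>k. norm (x k + y k) powr p) \<le> suminf ?g"
      using v sg by (intro suminf_le le) auto
    also have "\<dots> = 2 powr p * (?a powr p + ?b powr p)"
      unfolding seq_norm_Ell_powr[OF p(1,4)] seq_norm_Ell_powr[OF p(1,5)]
      using p by (subst suminf_mult) (auto intro: summable_add simp: suminf_add)
    also have "\<dots> \<le> 2 powr p * (2 powr p * (?a + ?b) powr p)"
    proof (rule mult_left_mono)
      have "?a powr p \<le> (?a + ?b) powr p" "?b powr p \<le> (?a + ?b) powr p"
        using p nn by (auto intro!: powr_mono2 simp del: seq_norm.simps)
      moreover have "2 \<le> 2 powr p" using p powr_mono[of 1 p 2] by simp
      then have "2 * (?a + ?b) powr p \<le> 2 powr p * (?a + ?b) powr p"
        by (rule mult_right_mono) simp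
      ultimately show "?a powr p + ?b powr p \<le> 2 powr p * (?a + ?b) powr p" by linarith
    qed simp
    also have "\<dots> = (2 * (2 * (?a + ?b))) powr p"
      using nn by (simp only: powr_mult)
    also have "2 * (2 * (?a + ?b)) = 4 * (?a + ?b)" by simp
    finally show ?thesis
      using v nn p unfolding Ell by (auto intro!: seq_norm_Ell_leI simp del: seq_norm.simps)
  qed
  then show "(\<lambda>k. x k + y k) \<in> vectors S"
    and "seq_norm S (\<lambda>k. x k + y k) \<le> 4 * (seq_norm S x + seq_norm S y)" by auto
qed

lemma unit_vec_in_vectors:
  assumes "valid_space S" "j \<in> indices S"
  shows "unit_vec j \<in> vectors S"
proof (cases S)
  case (Ell p)
  have "summable (\<lambda>k. norm (unit_vec j k) powr p)"
    by (rule summable_finite[of "{j}"]) (auto simp: unit_vec_def)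
  then show ?thesis using Ell by simp
next
  case C_Zero
  have "\<forall>\<^sub>F k in sequentially. unit_vec j k = 0"
    using eventually_gt_at_top[of j] by eventually_elim (simp add: unit_vec_def)
  then show ?thesis using C_Zero by (simp add: tendsto_eventually)
next
  case (Fin_Dim d)
  then show ?thesis using assms by (auto simp: unit_vec_def)
qed

lemma seq_norm_unit_vec_le:
  assumes "valid_space S"
  shows "seq_norm S (unit_vec j) \<le> 1"
proof (cases S)
  case (Ell p)
  have "(\<Sum>k. norm (unit_vec j k) powr p) = (\<Sum>k\<in>{j}. norm (unit_vec j k) powr p)"
    by (rule suminf_finite) (auto simp: unit_vec_def)
  then show ?thesis using Ell by (simp add: unit_vec_def)
next
  case C_Zero
  then show ?thesis by (auto simp: unit_vec_def intro!: cSUP_least)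
next
  case (Fin_Dim d)
  have "L2_set (\<lambda>k. norm (unit_vec j k)) {..<d} \<le> (\<Sum>k<d. norm (unit_vec j k))"
    by (rule L2_set_le_sum) simp
  also have "\<dots> = (\<Sum>k<d. if k = j then 1 else 0)"
    by (intro sum.cong) (auto simp: unit_vec_def)
  also have "\<dots> \<le> 1" by simp
  finally show ?thesis using Fin_Dim by simp
qed

text \<open>
  Finitely supported vectors are dense, which is where \<open>c\<^sub>0\<close> and finite exponents matter: the
  statement fails in \<open>\<ell>\<^sup>\<infinity>\<close>.
\<close>

lemma seq_norm_tail_tendsto_0:
  assumes "valid_space S" "x \<in> vectors S"
  shows "(\<lambda>N. seq_norm S (\<lambda>k. if k < N then 0 else x k)) \<longlonglongrightarrow> 0"
proof (cases S)
  case (Fin_Dim d)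
  have "seq_norm S (\<lambda>k. if k < N then 0 else x k) = 0" if "N \<ge> d" for N
    unfolding Fin_Dim seq_norm.simps by (rule L2_set_0') (use that in auto)
  then show ?thesis
    by (intro tendsto_eventually) (auto simp: eventually_at_top_linorder)
next
  case C_Zero
  show ?thesis
  proof (rule LIMSEQ_I)
    fix r :: real assume "0 < r"
    then obtain N0 where N0: "\<And>k. k \<ge> N0 \<Longrightarrow> norm (x k) < r / 2"
      using assms C_Zero LIMSEQ_D[of x 0 "r / 2"] by auto
    have "norm (seq_norm S (\<lambda>k. if k < N then 0 else x k) - 0) < r" if "N \<ge> N0" for N
    proof -
      have "seq_norm S (\<lambda>k. if k < N then 0 else x k) \<le> r / 2"
        unfolding C_Zero seq_norm.simps
        by (rule cSUP_least) (use N0 that \<open>0 < r\<close> in \<open>auto simp: less_imp_le\<close>)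
      moreover have "(\<lambda>k. if k < N then 0 else x k) \<in> vectors S"
        by (rule vectors_dominated[OF assms, of _ 1]) auto
      then have "0 \<le> seq_norm S (\<lambda>k. if k < N then 0 else x k)"
        by (rule seq_norm_nonneg[OF assms(1)])
      ultimately show ?thesis using \<open>0 < r\<close> by simp
    qed
    then show "\<exists>no. \<forall>n\<ge>no. norm (seq_norm S (\<lambda>k. if k < n then 0 else x k) - 0) < r"
      by blast
  qed
next
  case (Ell p)
  let ?f = "\<lambda>k. norm (x k) powr p"
  have p: "1 \<le> p" "summable ?f" using assms Ell by auto
  have "(\<Sum>k. norm (if k < N then 0 else x k) powr p) = suminf ?f - sum ?f {..<N}" for N
  proof -
    have "(\<lambda>k. ?f k - (if k \<in> {..<N} then ?f k else 0)) sums (suminf ?f - sum ?f {..<N})"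
      by (intro sums_diff summable_sums[OF p(2)] sums_If_finite_set) auto
    then have "(\<lambda>k. norm (if k < N then 0 else x k) powr p) sums (suminf ?f - sum ?f {..<N})"
      by (rule sums_cong[THEN iffD1, rotated]) (use p in auto)
    then show ?thesis by (rule sums_unique[symmetric])
  qed
  moreover have "(\<lambda>N. suminf ?f - sum ?f {..<N}) \<longlonglongrightarrow> 0"
    using tendsto_diff[OF tendsto_const summable_LIMSEQ[OF p(2)], of "suminf ?f"] by simp
  moreover have "0 \<le> suminf ?f - sum ?f {..<N}" for N
    using sum_le_suminf[OF p(2), of "{..<N}"] by simp
  ultimately show ?thesis
    unfolding Ell seq_norm.simps using p
    by (auto intro!: tendsto_eq_intros summable_LIMSEQ)
qed

section \<open>Bounded operators and their entries\<close>

lemma bounded_op_in_vectors: "bounded_op S A \<Longrightarrow> x \<in> vectors S \<Longrightarrow> A x \<in> vectors S"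
  by (simp add: bounded_op_def)

lemma bounded_op_additive:
  "bounded_op S A \<Longrightarrow> x \<in> vectors S \<Longrightarrow> y \<in> vectors S \<Longrightarrow>
    A (\<lambda>k. x k + y k) = (\<lambda>k. A x k + A y k)"
  by (simp add: bounded_op_def)

lemma bounded_op_homogeneous:
  "bounded_op S A \<Longrightarrow> x \<in> vectors S \<Longrightarrow> A (\<lambda>k. c * x k) = (\<lambda>k. c * A x k)"
  by (simp add: bounded_op_def)

lemma bounded_op_bound:
  assumes "valid_space S" "bounded_op S A"
  obtains M where "0 \<le> M" "\<And>x. x \<in> vectors S \<Longrightarrow> seq_norm S (A x) \<le> M * seq_norm S x"
proof -
  obtain M where M: "\<forall>x\<in>vectors S. seq_norm S (A x) \<le> M * seq_norm S x"
    using assms(2) by (auto simp: bounded_op_def)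
  have "seq_norm S (A x) \<le> \<bar>M\<bar> * seq_norm S x" if "x \<in> vectors S" for x
    using M that mult_right_mono[OF abs_ge_self seq_norm_nonneg[OF assms(1) that], of M]
    by fastforce
  then show ?thesis by (intro that[of "\<bar>M\<bar>"]) auto
qed

lemma vectors_scale:
  assumes "valid_space S" "x \<in> vectors S"
  shows "(\<lambda>k. c * x k) \<in> vectors S"
  by (rule vectors_dominated[OF assms, of _ "norm c"]) (simp add: norm_mult)

lemma bounded_op_add:
  assumes S: "valid_space S" and A: "bounded_op S A" and B: "bounded_op S B"
  shows "bounded_op S (\<lambda>x k. A x k + B x k)"
proof -
  obtain M where M: "\<And>x. x \<in> vectors S \<Longrightarrow> seq_norm S (A x) \<le> M * seq_norm S x"
    using bounded_op_bound[OF S A] by blast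
  obtain N where N: "\<And>x. x \<in> vectors S \<Longrightarrow> seq_norm S (B x) \<le> N * seq_norm S x"
    using bounded_op_bound[OF S B] by blast
  have "seq_norm S (\<lambda>k. A x k + B x k) \<le> (4 * (M + N)) * seq_norm S x" if "x \<in> vectors S" for x
  proof -
    have "seq_norm S (\<lambda>k. A x k + B x k) \<le> 4 * (seq_norm S (A x) + seq_norm S (B x))"
      by (rule seq_norm_quasi_triangle[OF S bounded_op_in_vectors[OF A that]
            bounded_op_in_vectors[OF B that]])
    also have "\<dots> \<le> 4 * (M * seq_norm S x + N * seq_norm S x)"
      using M[OF that] N[OF that] by simp
    finally show ?thesis by (simp add: algebra_simps)
  qed
  then have "\<exists>K. \<forall>x\<in>vectors S. seq_norm S (\<lambda>k. A x k + B x k) \<le> K * seq_norm S x"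
    by blast
  moreover have "(\<lambda>k. A x k + B x k) \<in> vectors S" if "x \<in> vectors S" for x
    by (rule vectors_add[OF S bounded_op_in_vectors[OF A that] bounded_op_in_vectors[OF B that]])
  ultimately show ?thesis
    using A B unfolding bounded_op_def by (simp add: algebra_simps)
qed

lemma bounded_op_scale:
  assumes S: "valid_space S" and A: "bounded_op S A"
  shows "bounded_op S (\<lambda>x k. c * A x k)"
proof -
  obtain M where M: "\<And>x. x \<in> vectors S \<Longrightarrow> seq_norm S (A x) \<le> M * seq_norm S x"
    using bounded_op_bound[OF S A] by blast
  have "seq_norm S (\<lambda>k. c * A x k) \<le> (norm c * M) * seq_norm S x" if "x \<in> vectors S" for x
  proof -
    have "seq_norm S (\<lambda>k. c * A x k) \<le> norm c * seq_norm S (A x)"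
      by (rule seq_norm_dominated[OF S bounded_op_in_vectors[OF A that]]) (auto simp: norm_mult)
    also have "\<dots> \<le> norm c * (M * seq_norm S x)"
      using M[OF that] by (rule mult_left_mono) simp
    finally show ?thesis by (simp add: algebra_simps)
  qed
  then have "\<exists>K. \<forall>x\<in>vectors S. seq_norm S (\<lambda>k. c * A x k) \<le> K * seq_norm S x"
    by blast
  moreover have "(\<lambda>k. c * A x k) \<in> vectors S" if "x \<in> vectors S" for x
    by (rule vectors_scale[OF S bounded_op_in_vectors[OF A that]])
  ultimately show ?thesis
    using A unfolding bounded_op_def by (simp add: algebra_simps)
qed

text \<open>
  The operator norm is a supremum of reals, which bounds the individual values only if the set is
  bounded above; for a bounded operator it is, and testing on the unit vector \<open>e\<^sub>j\<close>, of norm at most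
  \<open>1\<close>, gives the bound on entries.
\<close>

lemma entry_le_op_norm:
  assumes S: "valid_space S" and A: "bounded_op S A" and j: "j \<in> indices S"
  shows "norm (entry A i j) \<le> op_norm S A"
proof -
  obtain M where M: "0 \<le> M" "\<And>x. x \<in> vectors S \<Longrightarrow> seq_norm S (A x) \<le> M * seq_norm S x"
    using bounded_op_bound[OF S A] by blast
  have u: "unit_vec j \<in> vectors S" using unit_vec_in_vectors[OF S j] .
  have "norm (entry A i j) \<le> seq_norm S (A (unit_vec j))"
    unfolding entry_def using coord_le_seq_norm[OF S bounded_op_in_vectors[OF A u]] .
  also have "\<dots> \<le> op_norm S A"
    unfolding op_norm_def
  proof (rule cSUP_upper)
    show "unit_vec j \<in> {x \<in> vectors S. seq_norm S x \<le> 1}"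
      using u seq_norm_unit_vec_le[OF S] by simp
    have "seq_norm S (A x) \<le> M" if "x \<in> vectors S" "seq_norm S x \<le> 1" for x
      using M(2)[OF that(1)] mult_left_mono[OF that(2) M(1)] by simp
    then show "bdd_above ((\<lambda>x. seq_norm S (A x)) ` {x \<in> vectors S. seq_norm S x \<le> 1})"
      by (intro bdd_aboveI2[of _ _ M]) auto
  qed
  finally show ?thesis .
qed

section \<open>Positive operators\<close>

text \<open>
  On finitely supported vectors positivity of the operator is immediate from that of the entries,
  by adding one coordinate at a time. In the finite-dimensional case coordinates outside the index
  set contribute nothing, since there the vector vanishes.
\<close>

lemma positive_matrix_head:
  assumes S: "valid_space S" and A: "bounded_op S A" "positive_matrix S A"
    and x: "x \<in> vectors S" "\<And>k. 0 \<le> x k" and i: "i \<in> indices S"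
  shows "0 \<le> A (\<lambda>k. if k < N then x k else 0) i"
proof (induction N)
  case 0
  have "(\<lambda>k. 0 * x k) \<in> vectors S" by (rule vectors_scale[OF S x(1)])
  then show ?case using bounded_op_homogeneous[OF A(1) x(1), of 0] by simp
next
  case (Suc N)
  let ?h = "\<lambda>N k. if k < N then x k else 0"
  have h: "?h N \<in> vectors S" by (rule vectors_dominated[OF S x(1), of _ 1]) auto
  show ?case
  proof (cases "N \<in> indices S")
    case True
    note u = unit_vec_in_vectors[OF S True]
    have "?h (Suc N) = (\<lambda>k. ?h N k + x N * unit_vec N k)"
      by (auto simp: unit_vec_def less_Suc_eq fun_eq_iff)
    then have "A (?h (Suc N)) i = A (?h N) i + x N * entry A i N"
      by (simp only: bounded_op_additive[OF A(1) h vectors_scale[OF S u]]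
          bounded_op_homogeneous[OF A(1) u] entry_def)
    moreover have "0 \<le> x N * entry A i N"
      using x(2) A(2) i True by (auto simp: positive_matrix_def intro!: mult_nonneg_nonneg)
    ultimately show ?thesis using Suc.IH by simp
  next
    case False
    then have "x N = 0" using x(1) by (cases S) auto
    then have "?h (Suc N) = ?h N" by (auto simp: less_Suc_eq)
    then show ?thesis using Suc.IH by simp
  qed
qed

text \<open>
  Entrywise positivity gives positivity on all nonnegative vectors: approximate by truncations and
  use that the nonnegative reals are closed in the complex plane.
\<close>

lemma positive_matrix_preserves_nonneg:
  assumes S: "valid_space S" and A: "bounded_op S A" "positive_matrix S A"
    and x: "x \<in> vectors S" "\<And>k. 0 \<le> x k" and i: "i \<in> indices S"
  shows "0 \<le> A x i"
proof -
  let ?h = "\<lambda>N k. if k < N then x k else 0" and ?t = "\<lambda>N k. if k < N then 0 else x k"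
  \<comment> \<open>\<open>?h N\<close> is the truncation to the first \<open>N\<close> coordinates and \<open>?t N\<close> the tail.\<close>
  have h: "?h N \<in> vectors S" and t: "?t N \<in> vectors S" for N
    by (rule vectors_dominated[OF S x(1), of _ 1]; simp)+
  obtain M where M: "\<And>x. x \<in> vectors S \<Longrightarrow> seq_norm S (A x) \<le> M * seq_norm S x"
    using bounded_op_bound[OF S A(1)] by blast
  have split: "A x i = A (?h N) i + A (?t N) i" for N
  proof -
    have "x = (\<lambda>k. ?h N k + ?t N k)" by auto
    then show ?thesis using bounded_op_additive[OF A(1) h t, of N N] by metis
  qed
  have "(\<lambda>N. A (?t N) i) \<longlonglongrightarrow> 0"
  proof (rule Lim_null_comparison)
    show "(\<lambda>N. M * seq_norm S (?t N)) \<longlonglongrightarrow> 0"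
      by (rule tendsto_mult_right_zero[OF seq_norm_tail_tendsto_0[OF S x(1)]])
    show "\<forall>\<^sub>F N in sequentially. norm (A (?t N) i) \<le> M * seq_norm S (?t N)"
      using M[OF t] coord_le_seq_norm[OF S bounded_op_in_vectors[OF A(1) t]] order_trans
      by (intro always_eventually) blast
  qed
  then have "(\<lambda>N. A x i - A (?t N) i) \<longlonglongrightarrow> A x i - 0"
    by (intro tendsto_diff tendsto_const)
  moreover have "A x i - A (?t N) i = A (?h N) i" for N
    using split[of N] by simp
  ultimately have lim: "(\<lambda>N. A (?h N) i) \<longlonglongrightarrow> A x i" by simp
  have pos: "0 \<le> A (?h N) i" for N
    by (rule positive_matrix_head[OF S A x i])
  have "0 \<le> Re (A x i)"
    using tendsto_Re[OF lim] pos by (intro LIMSEQ_le_const) (auto simp: less_eq_complex_def)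
  moreover have "Im (A x i) = 0"
    using tendsto_Im[OF lim] pos LIMSEQ_unique[OF _ tendsto_const[of 0]]
    by (simp add: less_eq_complex_def)
  ultimately show ?thesis by (simp add: less_eq_complex_def)
qed

text \<open>
  The coordinate \<open>(A x)\<^sub>i\<close> is morally the series \<open>\<Sum>\<^sub>k a\<^sub>i\<^sub>k x\<^sub>k\<close> of nonnegative terms, so it dominates each
  of them. The series itself need not be formed: splitting off the \<open>k\<close>-th coordinate leaves a
  nonnegative vector, whose image is nonnegative.
\<close>

lemma positive_matrix_apply_ge_term:
  assumes S: "valid_space S" and A: "bounded_op S A" "positive_matrix S A"
    and x: "x \<in> vectors S" "\<And>k. k \<in> indices S \<Longrightarrow> 0 \<le> x k"
    and i: "i \<in> indices S" and k: "k \<in> indices S"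
  shows "entry A i k * x k \<le> A x i"
proof -
  have nn: "0 \<le> x l" for l
    using x by (cases "l \<in> indices S"; cases S) auto
  let ?r = "x(k := 0)"
  note u = unit_vec_in_vectors[OF S k]
  have r: "?r \<in> vectors S" by (rule vectors_dominated[OF S x(1), of _ 1]) auto
  have "x = (\<lambda>l. ?r l + x k * unit_vec k l)"
    by (auto simp: unit_vec_def fun_eq_iff)
  then have "A x i = A ?r i + x k * entry A i k"
    using bounded_op_additive[OF A(1) r vectors_scale[OF S u, of "x k"]]
      bounded_op_homogeneous[OF A(1) u, of "x k"] by (metis entry_def)
  moreover have "0 \<le> A ?r i"
    using nn by (intro positive_matrix_preserves_nonneg[OF S A r _ i]) auto
  ultimately show ?thesis by (simp add: mult.commute)
qed

section \<open>Entries of positive semigroups\<close>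

text \<open>
  The left-hand side is one term of the matrix product \<open>T(s) T(t)\<close>. The choice \<open>i = k = j\<close> controls the
  diagonal, the choice \<open>k = i\<close> the off-diagonal zeros.
\<close>

lemma entry_semigroup_ge:
  assumes S: "valid_space S" and T: "positive_C0_semigroup S T"
    and "0 \<le> s" "0 \<le> t" and ijk: "i \<in> indices S" "j \<in> indices S" "k \<in> indices S"
  shows "entry (T s) i k * entry (T t) k j \<le> entry (T (s + t)) i j"
proof -
  have b: "bounded_op S (T s)" "bounded_op S (T t)"
    and p: "positive_matrix S (T s)" "positive_matrix S (T t)"
    using T assms by (auto simp: positive_C0_semigroup_def C0_semigroup_def)
  note u = unit_vec_in_vectors[OF S ijk(2)]
  have "T (s + t) (unit_vec j) = T s (T t (unit_vec j))"
    using T assms u by (auto simp: positive_C0_semigroup_def C0_semigroup_def)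
  then show ?thesis
    using positive_matrix_apply_ge_term[OF S b(1) p(1) bounded_op_in_vectors[OF b(2) u] _ ijk(1,3)]
      p(2) ijk by (simp add: entry_def positive_matrix_def)
qed

lemma entry_tendsto_at_0:
  assumes S: "valid_space S" and T: "C0_semigroup S T" and j: "j \<in> indices S"
  shows "((\<lambda>s. entry (T s) i j) \<longlongrightarrow> unit_vec j i) (at 0 within {0..})"
proof -
  note u = unit_vec_in_vectors[OF S j]
  have T0: "T 0 (unit_vec j) = unit_vec j" using T u by (auto simp: C0_semigroup_def)
  have lim: "((\<lambda>s. seq_norm S (\<lambda>k. T s (unit_vec j) k - unit_vec j k)) \<longlongrightarrow> 0) (at 0 within {0..})"
    using T u T0 by (fastforce simp: C0_semigroup_def)
  have "((\<lambda>s. entry (T s) i j - unit_vec j i) \<longlongrightarrow> 0) (at 0 within {0..})"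
  proof (rule Lim_null_comparison[OF _ lim])
    have "norm (entry (T s) i j - unit_vec j i)
        \<le> seq_norm S (\<lambda>k. T s (unit_vec j) k - unit_vec j k)" if "s \<ge> 0" for s
    proof -
      have "bounded_op S (T s)" using T that by (simp add: C0_semigroup_def)
      from vectors_add[OF S bounded_op_in_vectors[OF this u] vectors_scale[OF S u, of "-1"]]
      have "(\<lambda>k. T s (unit_vec j) k - unit_vec j k) \<in> vectors S" by simp
      then show ?thesis
        unfolding entry_def using coord_le_seq_norm[OF S, of _ i] by fastforce
    qed
    then show "\<forall>\<^sub>F s in at 0 within {0..}. norm (entry (T s) i j - unit_vec j i)
        \<le> seq_norm S (\<lambda>k. T s (unit_vec j) k - unit_vec j k)"
      by (auto simp: eventually_at_filter)
  qed
  then show ?thesis by (rule LIM_zero_cancel)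
qed

text \<open>
  Strong continuity makes \<open>a\<^sub>j\<^sub>j(s)\<close> close to \<open>a\<^sub>j\<^sub>j(0) = 1\<close>, hence positive, for small \<open>s\<close>. Writing
  \<open>t = n s\<close> with such an \<open>s\<close>, supermultiplicativity \<open>a\<^sub>j\<^sub>j(s + r) \<ge> a\<^sub>j\<^sub>j(s) a\<^sub>j\<^sub>j(r)\<close> propagates positivity
  from \<open>s\<close> to \<open>t\<close>.
\<close>

lemma diagonal_entry_pos:
  assumes S: "valid_space S" and T: "positive_C0_semigroup S T" and j: "j \<in> indices S"
    and t: "0 \<le> t"
  shows "0 < entry (T t) j j"
proof -
  have C0: "C0_semigroup S T" using T by (simp add: positive_C0_semigroup_def)
  let ?a = "\<lambda>s. entry (T s) j j"
  have nn: "0 \<le> ?a s" if "0 \<le> s" for s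
    using T j that by (auto simp: positive_C0_semigroup_def positive_matrix_def)
  have a0: "?a 0 = 1"
    using C0 unit_vec_in_vectors[OF S j] by (simp add: C0_semigroup_def entry_def unit_vec_def)
  have "(?a \<longlongrightarrow> 1) (at 0 within {0..})"
    using entry_tendsto_at_0[OF S C0 j, of j] by (simp add: unit_vec_def)
  then have "\<forall>\<^sub>F s in at 0 within {0..}. ?a s \<noteq> 0"
    by (rule tendsto_imp_eventually_ne) simp
  then obtain d where d: "d > 0" "\<And>s. s \<in> {0..} \<Longrightarrow> s \<noteq> 0 \<Longrightarrow> dist s 0 < d \<Longrightarrow> ?a s \<noteq> 0"
    by (auto simp: eventually_at)
  obtain n :: nat where n: "t / d < real n" using reals_Archimedean2 by blast
  then have "0 < real n" using t d(1) by (smt (verit) divide_nonneg_pos)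
  define s where "s = t / real n"
  have s: "0 \<le> s" "s < d" "t = real n * s"
    using t n d(1) \<open>0 < real n\<close> by (auto simp: s_def field_simps)
  have as: "0 < ?a s"
    using nn[OF s(1)] d(2)[of s] s(1,2) a0 by (cases "s = 0") (auto simp: order_less_le)
  have "0 < ?a (real m * s)" for m
  proof (induction m)
    case 0
    then show ?case using a0 by (simp add: less_complex_def)
  next
    case (Suc m)
    have "0 < ?a s * ?a (real m * s)"
      using as Suc.IH by (simp add: less_complex_def)
    also have "\<dots> \<le> ?a (s + real m * s)"
      using s(1) j by (intro entry_semigroup_ge[OF S T]) auto
    finally show ?case by (simp add: algebra_simps)
  qed
  then show ?thesis using s(3) by simp
qed

section \<open>Entries of analytic semigroups\<close>

lemma open_sector:
  assumes "\<delta> \<le> pi"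
  shows "open (sector \<delta>)"
proof -
  have "z \<notin> \<real>\<^sub>\<le>\<^sub>0" if "z \<noteq> 0" "\<bar>Arg z\<bar> < \<delta>" for z
  proof
    assume "z \<in> \<real>\<^sub>\<le>\<^sub>0"
    then have "Arg z = pi"
      using that(1) by (auto simp: Arg_eq_pi complex_nonpos_Reals_iff complex_eq_iff)
    then show False using that(2) assms by simp
  qed
  then have "sector \<delta> = (- \<real>\<^sub>\<le>\<^sub>0) \<inter> Arg -` {-\<delta><..<\<delta>}"
    by (auto simp: sector_def abs_less_iff)
  moreover have "open ((- \<real>\<^sub>\<le>\<^sub>0) \<inter> Arg -` {-\<delta><..<\<delta>})"
    by (intro continuous_open_preimage continuous_on_Arg) auto
  ultimately show ?thesis by simp
qed

text \<open>
  The sector is the image of a horizontal strip, which is convex, under the exponential.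
\<close>

lemma connected_sector:
  assumes "\<delta> \<le> pi"
  shows "connected (sector \<delta>)"
proof -
  let ?strip = "{w. \<bar>Im w\<bar> < \<delta>}"
  have "sector \<delta> = exp ` ?strip"
  proof (intro equalityI subsetI)
    fix z assume "z \<in> sector \<delta>"
    then have "z = exp (Ln z)" "Ln z \<in> ?strip"
      by (auto simp: sector_def Arg_eq_Im_Ln)
    then show "z \<in> exp ` ?strip" by blast
  next
    fix z assume "z \<in> exp ` ?strip"
    then show "z \<in> sector \<delta>" using assms by (auto simp: sector_def Arg_exp)
  qed
  moreover have "?strip = {w. Im w < \<delta>} \<inter> {w. Im w > -\<delta>}" by auto
  then have "convex ?strip"
    by (simp add: convex_Int convex_halfspace_Im_lt convex_halfspace_Im_gt)
  then have "connected (exp ` ?strip)"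
    by (intro connected_continuous_image convex_connected continuous_intros)
  ultimately show ?thesis by simp
qed

text \<open>
  Taking an entry is linear and bounded by the operator norm, so it carries the operator-valued
  derivative to a complex derivative. The difference quotient has to be known to be a bounded
  operator before its entry can be compared with its operator norm; as the sector is open, this
  holds for all small increments.
\<close>

lemma entry_holomorphic_on_sector:
  assumes S: "valid_space S" and \<delta>: "\<delta> \<le> pi"
    and U: "analytic_semigroup_of_angle S \<delta> U" and j: "j \<in> indices S"
  shows "(\<lambda>z. entry (U z) i j) holomorphic_on sector \<delta>"
  unfolding holomorphic_on_open[OF open_sector[OF \<delta>]]
proof
  fix z assume z: "z \<in> sector \<delta>"
  have b: "bounded_op S (U w)" if "w \<in> sector \<delta>" for w
    using U that by (auto simp: analytic_semigroup_of_angle_def)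
  obtain D where D: "bounded_op S D"
    and lim: "((\<lambda>h. op_norm S (\<lambda>x k. (U (z + h) x k - U z x k) / h - D x k)) \<longlongrightarrow> 0) (at 0)"
    using U z by (auto simp: analytic_semigroup_of_angle_def op_differentiable_def)
  have "((\<lambda>h. z + h) \<longlongrightarrow> z + 0) (at 0)" by (intro tendsto_intros)
  then have ev: "\<forall>\<^sub>F h in at 0. z + h \<in> sector \<delta>"
    using topological_tendstoD[OF _ open_sector[OF \<delta>]] z by fastforce
  have "((\<lambda>h. (entry (U (z + h)) i j - entry (U z) i j) / h - entry D i j) \<longlongrightarrow> 0) (at 0)"
  proof (rule Lim_null_comparison[OF _ lim])
    show "\<forall>\<^sub>F h in at 0. norm ((entry (U (z + h)) i j - entry (U z) i j) / h - entry D i j)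
        \<le> op_norm S (\<lambda>x k. (U (z + h) x k - U z x k) / h - D x k)"
      using ev
    proof eventually_elim
      fix h assume h: "z + h \<in> sector \<delta>"
      \<comment> \<open>The quotient is written as a linear combination, to which the closure lemmas apply.\<close>
      have "bounded_op S (\<lambda>x k. inverse h * (U (z + h) x k + (-1) * U z x k) + (-1) * D x k)"
        using b[OF h] b[OF z] D by (intro bounded_op_add bounded_op_scale S)
      then have "bounded_op S (\<lambda>x k. (U (z + h) x k - U z x k) / h - D x k)"
        by (simp add: divide_inverse mult.commute)
      from entry_le_op_norm[OF S this j, of i]
      show "norm ((entry (U (z + h)) i j - entry (U z) i j) / h - entry D i j)
        \<le> op_norm S (\<lambda>x k. (U (z + h) x k - U z x k) / h - D x k)"
        by (simp add: entry_def)
    qed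
  qed
  then have "((\<lambda>z. entry (U z) i j) has_field_derivative entry D i j) (at z)"
    unfolding DERIV_def by (rule LIM_zero_cancel)
  then show "\<exists>f'. ((\<lambda>z. entry (U z) i j) has_field_derivative f') (at z)" ..
qed

text \<open>
  The identity theorem: the zeros of the holomorphic entry on the sector include the interval
  \<open>(0, 1]\<close>, whose endpoint \<open>1\<close> is an accumulation point inside the sector.
\<close>

lemma analytic_semigroup_entry_zero:
  assumes S: "valid_space S" and T: "analytic_semigroup S T" and j: "j \<in> indices S"
    and zero: "\<And>t. t \<in> {0<..1} \<Longrightarrow> entry (T t) i j = 0" and t: "0 < t"
  shows "entry (T t) i j = 0"
proof -
  obtain \<delta> U where \<delta>: "0 < \<delta>" "\<delta> \<le> pi / 2" and U: "analytic_semigroup_of_angle S \<delta> U"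
    and UT: "\<And>t x. t \<ge> 0 \<Longrightarrow> x \<in> vectors S \<Longrightarrow> U (of_real t) x = T t x"
    using T by (auto simp: analytic_semigroup_def)
  have \<delta>': "\<delta> \<le> pi" using \<delta>(2) pi_gt_zero by linarith
  have UT: "entry (U (of_real s)) i j = entry (T s) i j" if "s \<ge> 0" for s
    using UT[OF that unit_vec_in_vectors[OF S j]] by (simp add: entry_def)
  have pos: "of_real s \<in> sector \<delta>" if "s > 0" for s :: real
    using that \<delta>(1) by (simp add: sector_def Arg_of_real)
  let ?I = "complex_of_real ` {0<..1}"
  have limpt: "1 islimpt ?I"
  proof (rule connected_imp_perfect)
    show "connected ?I" by (intro connected_continuous_image continuous_intros) auto
    show "1 \<in> ?I" by force
    have "complex_of_real (1/2) \<in> ?I" by (intro imageI) auto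
    moreover have "complex_of_real (1/2) \<noteq> 1" by (simp del: of_real_divide)
    ultimately show "?I \<noteq> {w}" for w using \<open>1 \<in> ?I\<close> by (metis singletonD)
  qed
  have "entry (U (of_real t)) i j = 0"
  proof (rule analytic_continuation[OF entry_holomorphic_on_sector[OF S \<delta>' U j]
        open_sector[OF \<delta>'] connected_sector[OF \<delta>'] _ _ limpt])
    show "?I \<subseteq> sector \<delta>" using pos by auto
    show "1 \<in> sector \<delta>" using pos[of 1] by simp
    show "of_real t \<in> sector \<delta>" by (rule pos[OF t])
    show "entry (U z) i j = 0" if "z \<in> ?I" for z
      using that zero UT by (auto simp: less_imp_le)
  qed
  then show ?thesis using UT t by simp
qed

section \<open>Zero pattern of embeddable matrices\<close>

theorem theorem3p3:
  fixes S :: seq_space and A :: seq_op and T :: "real \<Rightarrow> seq_op"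
  assumes "valid_space S"
    and "bounded_op S A"
    and "positive_matrix S A"
    and "positive_C0_semigroup S T"
    and "embeds_into S A T"
  shows "(\<forall>t\<ge>0. \<forall>j\<in>indices S. 0 < entry (T t) j j) \<and>
    (\<forall>i\<in>indices S. \<forall>j\<in>indices S. i \<noteq> j \<and> entry A i j = 0 \<longrightarrow>
       (\<forall>t\<in>{0..1}. entry (T t) i j = 0) \<and>
       (analytic_semigroup S T \<longrightarrow> (\<forall>t\<ge>0. entry (T t) i j = 0)))"
proof (intro conjI allI ballI impI)
  note S = assms(1) and T = assms(4)
  show "0 < entry (T t) j j" if "0 \<le> t" "j \<in> indices S" for t j
    using diagonal_entry_pos[OF S T that(2,1)] .
  have unit_interval: "entry (T t) i j = 0"
    if i: "i \<in> indices S" and j: "j \<in> indices S" and zero: "i \<noteq> j \<and> entry A i j = 0"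
      and t: "t \<in> {0..1}" for i j t
  proof -
    \<comment> \<open>As \<open>T(1) = T(1 - t) T(t)\<close>, the zero \<open>a\<^sub>i\<^sub>j(1)\<close> dominates a product whose first factor is positive.\<close>
    have "entry (T (1 - t)) i i * entry (T t) i j \<le> entry (T (1 - t + t)) i j"
      using t i j by (intro entry_semigroup_ge[OF S T]) auto
    also have "entry (T (1 - t + t)) i j = 0"
      using assms(5) unit_vec_in_vectors[OF S j] zero by (simp add: embeds_into_def entry_def)
    finally have "entry (T (1 - t)) i i * entry (T t) i j \<le> 0" .
    moreover have "0 < entry (T (1 - t)) i i"
      using diagonal_entry_pos[OF S T i] t by simp
    moreover have "0 \<le> entry (T t) i j"
      using T i j t by (auto simp: positive_C0_semigroup_def positive_matrix_def)
    ultimately show ?thesis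
      by (auto simp: less_complex_def less_eq_complex_def complex_eq_iff mult_le_0_iff)
  qed
  then show "entry (T t) i j = 0"
    if "i \<in> indices S" "j \<in> indices S" "i \<noteq> j \<and> entry A i j = 0" "t \<in> {0..1}" for i j t
    using that by blast
  show "entry (T t) i j = 0"
    if i: "i \<in> indices S" and j: "j \<in> indices S" and zero: "i \<noteq> j \<and> entry A i j = 0"
      and an: "analytic_semigroup S T" and t: "0 \<le> t" for i j t
  proof (cases "t = 0")
    case True
    then show ?thesis using unit_interval[OF i j zero] by simp
  next
    case False
    then have "0 < t" using t by simp
    have "entry (T s) i j = 0" if "s \<in> {0<..1}" for s
      using unit_interval[OF i j zero, of s] that by simp
    from analytic_semigroup_entry_zero[OF S an j this \<open>0 < t\<close>] show ?thesis .
  qed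
qed

end
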